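(* Let $X$ be a separable Banach space and $C\subset X$ a non-empty, closed, convex and bounded set, and let $\mathcal{M}$ be the space of nonexpansive mappings $F:C\to\mathcal{K}(C)$ with the metric $\rho$ of uniform convergence. Then there is a residual set $\mathcal{F}\subset\mathcal{M}$ such that for every $F\in\mathcal{F}$ there is a residual subset $\mathcal{U}\subset C$ with the following property: for every $x_0\in\mathcal{U}$ the mapping $F$ admits a regular trajectory starting at $x_0$.
   Context: $C$ carries the metric induced by the norm. $\mathcal{K}(C)$ is the set of non-empty compact subsets of $C$ with the Pompeiu-Hausdorff distance $H(A,B)=\max\{\sup_{a\in A}\inf_{b\in B}\|a-b\|,\ \sup_{b\in B}\inf_{a\in A}\|a-b\|\}$. A mapping $F:C\to\mathcal{K}(C)$ is nonexpansive if $H(F(x),F(y))\le\|x-y\|$ for all $x,y\in C$. $\mathcal{M}$ denotes the set of all such mappings, with the complete metric $\rho(F,G)=\sup_{x\in C}H(F(x),G(x))$. For $M\subset X$ and $x\in X$, $P_M(x)=\{y\in M:\|x-y\|=\inf_{w\in M}\|x-w\|\}$. A trajectory (sequence of successive approximations) with respect to $F$ starting at $x_0$ is a sequence $(x_n)_{n=0}^\infty$ in $C$ with $x_{n+1}\in P_{F(x_n)}(x_n)$ for all $n$; it is called regular if $P_{F(x_n)}(x_n)$ is a singleton for all $n\ge 0$. A set is meagre if it is a countable union of nowhere dense sets; a residual set is the complement of a meagre set. *)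

theory Defs
  imports "HOL-Analysis.Analysis"
begin

definition nowhere_dense_in :: "'a topology \<Rightarrow> 'a set \<Rightarrow> bool" where
  "nowhere_dense_in X S \<longleftrightarrow> S \<subseteq> topspace X \<and> X interior_of (X closure_of S) = {}"

definition meagre_in :: "'a topology \<Rightarrow> 'a set \<Rightarrow> bool" where
  "meagre_in X S \<longleftrightarrow> (\<exists>T :: nat \<Rightarrow> 'a set. (\<forall>n. nowhere_dense_in X (T n)) \<and> S = (\<Union>n. T n))"

definition residual_in :: "'a topology \<Rightarrow> 'a set \<Rightarrow> bool" where
  "residual_in X S \<longleftrightarrow> S \<subseteq> topspace X \<and> meagre_in X (topspace X - S)"

definition compact_subsets :: "'a::metric_space set \<Rightarrow> 'a set set" where
  "compact_subsets C = {A. A \<noteq> {} \<and> A \<subseteq> C \<and> compact A}"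

text \<open>The suprema are meaningful only for non-empty bounded sets, the only ones used below.\<close>

definition hausdorff_dist :: "'a::metric_space set \<Rightarrow> 'a set \<Rightarrow> real" where
  "hausdorff_dist A B = max (SUP a\<in>A. infdist a B) (SUP b\<in>B. infdist b A)"

text \<open>Mappings defined on \<open>C\<close> only are represented by functions that are \<open>undefined\<close> off \<open>C\<close>;
  otherwise distinct functions could have distance zero.\<close>

definition nonexpansive_maps :: "'a::metric_space set \<Rightarrow> ('a \<Rightarrow> 'a set) set" where
  "nonexpansive_maps C =
     {F \<in> C \<rightarrow>\<^sub>E compact_subsets C. \<forall>x\<in>C. \<forall>y\<in>C. hausdorff_dist (F x) (F y) \<le> dist x y}"

text \<open>The value \<open>0\<close> off \<open>nonexpansive_maps C\<close> is a dummy: the locale \<open>Metric_space\<close> demands a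
  function that is non-negative and symmetric on the whole type.\<close>

definition unif_dist :: "'a::metric_space set \<Rightarrow> ('a \<Rightarrow> 'a set) \<Rightarrow> ('a \<Rightarrow> 'a set) \<Rightarrow> real" where
  "unif_dist C F G =
     (if F \<in> nonexpansive_maps C \<and> G \<in> nonexpansive_maps C
      then SUP x\<in>C. hausdorff_dist (F x) (G x) else 0)"

definition metric_proj :: "'a::metric_space set \<Rightarrow> 'a \<Rightarrow> 'a set" where
  "metric_proj M x = {y \<in> M. dist x y = infdist x M}"

definition trajectory ::
    "'a::metric_space set \<Rightarrow> ('a \<Rightarrow> 'a set) \<Rightarrow> 'a \<Rightarrow> (nat \<Rightarrow> 'a) \<Rightarrow> bool" where
  "trajectory C F x0 x \<longleftrightarrow>
     x 0 = x0 \<and> (\<forall>n. x n \<in> C) \<and> (\<forall>n. x (Suc n) \<in> metric_proj (F (x n)) (x n))"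

definition regular_trajectory ::
    "'a::metric_space set \<Rightarrow> ('a \<Rightarrow> 'a set) \<Rightarrow> 'a \<Rightarrow> (nat \<Rightarrow> 'a) \<Rightarrow> bool" where
  "regular_trajectory C F x0 x \<longleftrightarrow>
     trajectory C F x0 x \<and> (\<forall>n. is_singleton (metric_proj (F (x n)) (x n)))"

text \<open>\<open>Metric_space.mtopology\<close> is only meaningful for an actual metric, so we check that
  \<open>unif_dist C\<close> is one.\<close>

lemma infdist_le_hausdorff:
  assumes "bounded A" "bounded B" "B \<noteq> {}" "a \<in> A"
  shows "infdist a B \<le> hausdorff_dist A B"
proof -
  obtain b where b: "b \<in> B" using assms by auto
  obtain e where e: "\<And>x. x \<in> A \<Longrightarrow> dist b x \<le> e"
    using assms(1) bounded_any_center[of A b] by auto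
  have "bdd_above ((\<lambda>a. infdist a B) ` A)"
  proof (rule bdd_aboveI2)
    fix x assume "x \<in> A"
    then show "infdist x B \<le> e"
      using e[of x] infdist_le2[OF b, of x e] by (simp add: dist_commute)
  qed
  then have "infdist a B \<le> (SUP a\<in>A. infdist a B)"
    using assms(4) by (rule cSUP_upper[rotated])
  then show ?thesis by (simp add: hausdorff_dist_def)
qed

lemma hausdorff_dist_le:
  assumes "A \<noteq> {}" "B \<noteq> {}" "\<And>a. a \<in> A \<Longrightarrow> infdist a B \<le> r" "\<And>b. b \<in> B \<Longrightarrow> infdist b A \<le> r"
  shows "hausdorff_dist A B \<le> r"
  unfolding hausdorff_dist_def using assms by (auto intro!: cSUP_least)

lemma hausdorff_dist_commute: "hausdorff_dist A B = hausdorff_dist B A"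
  by (simp add: hausdorff_dist_def max.commute)

lemma hausdorff_dist_nonneg:
  assumes "bounded A" "bounded B" "A \<noteq> {}" "B \<noteq> {}"
  shows "0 \<le> hausdorff_dist A B"
  using assms infdist_le_hausdorff infdist_nonneg order_trans by (metis ex_in_conv)

lemma hausdorff_dist_triangle:
  assumes "bounded A" "bounded B" "bounded D" "A \<noteq> {}" "B \<noteq> {}" "D \<noteq> {}"
  shows "hausdorff_dist A D \<le> hausdorff_dist A B + hausdorff_dist B D"
proof -
  have *: "infdist a D' \<le> hausdorff_dist A' B + hausdorff_dist B D'"
    if "bounded A'" "bounded D'" "D' \<noteq> {}" "a \<in> A'" for a A' D'
  proof -
    have "infdist a D' - hausdorff_dist B D' \<le> infdist a B"
      unfolding infdist_notempty[OF assms(5)]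
    proof (rule cINF_greatest[OF assms(5)])
      fix b assume "b \<in> B"
      then have "infdist b D' \<le> hausdorff_dist B D'"
        using infdist_le_hausdorff assms(2) that by blast
      then show "infdist a D' - hausdorff_dist B D' \<le> dist a b"
        using infdist_triangle[of a D' b] by linarith
    qed
    then show ?thesis
      using infdist_le_hausdorff[OF that(1) assms(2,5) that(4)] by linarith
  qed
  show ?thesis
  proof (rule hausdorff_dist_le[OF assms(4,6)])
    show "infdist a D \<le> hausdorff_dist A B + hausdorff_dist B D" if "a \<in> A" for a
      using * assms that by blast
    show "infdist b A \<le> hausdorff_dist A B + hausdorff_dist B D" if "b \<in> D" for b
      using *[of D A b] assms that by (simp add: hausdorff_dist_commute add.commute)
  qed
qed

lemma hausdorff_dist_eq_0:
  assumes "compact A" "compact B" "A \<noteq> {}" "B \<noteq> {}"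
  shows "hausdorff_dist A B = 0 \<longleftrightarrow> A = B"
proof
  have *: "A' \<subseteq> B'" if "hausdorff_dist A' B' = 0" "compact A'" "compact B'" "B' \<noteq> {}"
    for A' B' :: "'a set"
  proof
    fix a assume "a \<in> A'"
    then have "infdist a B' = 0"
      using infdist_le_hausdorff[of A' B' a] infdist_nonneg[of a B'] that compact_imp_bounded
      by (metis order_antisym)
    then show "a \<in> B'"
      using that in_closed_iff_infdist_zero compact_imp_closed by blast
  qed
  show "A = B" if "hausdorff_dist A B = 0"
    using *[of A B] *[of B A] that assms by (auto simp: hausdorff_dist_commute)
  show "hausdorff_dist A B = 0" if "A = B"
    using that assms by (auto simp: hausdorff_dist_def)
qed

lemma Metric_space_nonexpansive_maps:
  fixes C :: "'a::metric_space set"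
  assumes "C \<noteq> {}" "bounded C"
  shows "Metric_space (nonexpansive_maps C) (unif_dist C)"
proof -
  have val: "F x \<noteq> {}" "F x \<subseteq> C" "compact (F x)" "bounded (F x)"
    if "F \<in> nonexpansive_maps C" "x \<in> C" for F x
    using that by (auto simp: nonexpansive_maps_def compact_subsets_def PiE_iff
        intro: compact_imp_bounded)
  obtain e where e: "\<And>x y. x \<in> C \<Longrightarrow> y \<in> C \<Longrightarrow> dist x y \<le> e"
    using assms(2) by (metis bounded_two_points)
  have bd: "hausdorff_dist (F x) (G x) \<le> unif_dist C F G"
    if F: "F \<in> nonexpansive_maps C" and G: "G \<in> nonexpansive_maps C" and x: "x \<in> C" for F G x
  proof -
    have "bdd_above ((\<lambda>x. hausdorff_dist (F x) (G x)) ` C)"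
    proof (rule bdd_aboveI2)
      fix y assume y: "y \<in> C"
      have "infdist a B \<le> e" if "a \<in> C" "B \<noteq> {}" "B \<subseteq> C" for a and B :: "'a set"
        using that e infdist_le2 by (metis ex_in_conv subsetD)
      then show "hausdorff_dist (F y) (G y) \<le> e"
        using val[OF F y] val[OF G y] by (intro hausdorff_dist_le) auto
    qed
    then show ?thesis
      using x F G by (auto simp: unif_dist_def intro: cSUP_upper)
  qed
  have hn: "0 \<le> hausdorff_dist (F x) (G x)"
    if "F \<in> nonexpansive_maps C" "G \<in> nonexpansive_maps C" "x \<in> C" for F G x
    using that val hausdorff_dist_nonneg by metis
  have least: "unif_dist C F G \<le> r"
    if "F \<in> nonexpansive_maps C" "G \<in> nonexpansive_maps C"
      "\<And>x. x \<in> C \<Longrightarrow> hausdorff_dist (F x) (G x) \<le> r" for F G r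
    using that assms(1) by (auto simp: unif_dist_def intro: cSUP_least)
  show ?thesis
  proof
    show nonneg: "0 \<le> unif_dist C F G" for F G
    proof (cases "F \<in> nonexpansive_maps C \<and> G \<in> nonexpansive_maps C")
      case True
      then show ?thesis
        using assms(1) hn bd order_trans by (metis ex_in_conv)
    next
      case False
      then show ?thesis by (auto simp: unif_dist_def)
    qed
    show "unif_dist C F G = unif_dist C G F" for F G
      by (simp add: unif_dist_def hausdorff_dist_commute conj_commute)
    fix F G assume F: "F \<in> nonexpansive_maps C" and G: "G \<in> nonexpansive_maps C"
    show "unif_dist C F G = 0 \<longleftrightarrow> F = G"
    proof
      assume 0: "unif_dist C F G = 0"
      show "F = G"
      proof (rule PiE_ext)
        show "F \<in> C \<rightarrow>\<^sub>E compact_subsets C" "G \<in> C \<rightarrow>\<^sub>E compact_subsets C"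
          using F G by (simp_all add: nonexpansive_maps_def)
        fix x assume x: "x \<in> C"
        have "hausdorff_dist (F x) (G x) = 0"
          using bd[OF F G x] hn[OF F G x] 0 by simp
        then show "F x = G x"
          using hausdorff_dist_eq_0 val F G x by metis
      qed
    next
      assume "F = G"
      then have "hausdorff_dist (F x) (G x) \<le> 0" if "x \<in> C" for x
        using hausdorff_dist_eq_0[of "F x" "G x"] val[OF F that] by simp
      then show "unif_dist C F G = 0"
        using least[OF F G] nonneg[of F G] by (meson order_antisym)
    qed
    fix K assume K: "K \<in> nonexpansive_maps C"
    show "unif_dist C F K \<le> unif_dist C F G + unif_dist C G K"
    proof (rule least[OF F K])
      fix x assume x: "x \<in> C"
      show "hausdorff_dist (F x) (K x) \<le> unif_dist C F G + unif_dist C G K"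
        using hausdorff_dist_triangle[of "F x" "G x" "K x"] val[OF F x] val[OF G x] val[OF K x]
          bd[OF F G x] bd[OF G K x] by simp
    qed
  qed
qed

end

theory Submission
  imports Defs
begin

text \<open>Let \<open>R\<^sub>n(F, x)\<close> be the set of \<open>n\<close>-th points of trajectories of \<open>F\<close> starting at \<open>x\<close>. A regular
  trajectory from \<open>x\<close> exists as soon as every \<open>R\<^sub>n(F, x)\<close> has diameter zero. The pairs \<open>(F, x)\<close> near
  which \<open>R\<^sub>n\<close> has diameter at most \<open>\<epsilon>\<close> form an open set, and separability of \<open>C\<close> allows one to pass,
  as in the Kuratowski-Ulam theorem, from its density to residual sets of \<open>F\<close> and of \<open>x\<close>.
  For density, first shrink \<open>F\<close> to a strict contraction and then treat the trajectory
  \<open>x\<^sub>0, x\<^sub>1, \<dots>\<close> point by point: replace each \<open>y \<in> F(x)\<close> by \<open>y + \<sigma>(x, y) (x\<^sub>i - y)\<close>, where \<open>\<sigma>\<close> is a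
  small Lipschitz bump with a strict maximum at \<open>(x\<^sub>i, x\<^sub>i\<^sub>+\<^sub>1)\<close> whose support avoids the earlier
  points. The image of \<open>x\<^sub>i\<^sub>+\<^sub>1\<close> becomes the unique nearest point, and a unique nearest point depends
  upper semicontinuously on all data.\<close>

section \<open>Residual sets\<close>

text \<open>Each complement \<open>topspace X - U i\<close> is closed with empty interior, hence
  nowhere dense. The map \<open>from_nat\<close> enumerates any countable index type, so tuples of
  naturals can index the conditions later on.\<close>

lemma residual_in_INT:
  fixes U :: "'i::countable \<Rightarrow> 'a set"
  assumes op: "\<And>i. openin X (U i)" and dense: "\<And>i. X closure_of U i = topspace X"
  shows "residual_in X (\<Inter>i. U i)"
  unfolding residual_in_def meagre_in_def
proof (intro conjI exI allI)
  show "(\<Inter>i. U i) \<subseteq> topspace X"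
    using openin_subset[OF op] by blast
  show "nowhere_dense_in X (topspace X - U (from_nat n))" for n
    by (simp add: nowhere_dense_in_def closure_of_closedin closedin_diff op interior_of_complement
        dense)
  show "topspace X - (\<Inter>i. U i) = (\<Union>n. topspace X - U (from_nat n))"
    by (auto, metis from_nat_to_nat)
qed

section \<open>Lipschitz mappings with compact values\<close>

text \<open>The constant is a parameter so that perturbations can be made on a strict contraction:
  the slack 1 - k absorbs the Lipschitz cost, and the result is still nonexpansive.\<close>

definition lipschitz_maps :: "real \<Rightarrow> 'a::metric_space set \<Rightarrow> ('a \<Rightarrow> 'a set) set" where
  "lipschitz_maps k C =
     {F \<in> C \<rightarrow>\<^sub>E compact_subsets C. \<forall>x\<in>C. \<forall>y\<in>C. hausdorff_dist (F x) (F y) \<le> k * dist x y}"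

lemma nonexpansive_maps_eq: "nonexpansive_maps C = lipschitz_maps 1 C"
  by (simp add: nonexpansive_maps_def lipschitz_maps_def)

lemma lipschitz_maps_mono:
  assumes "k \<le> l" shows "lipschitz_maps k C \<subseteq> lipschitz_maps l C"
proof
  fix F assume "F \<in> lipschitz_maps k C"
  moreover have "k * dist x y \<le> l * dist x y" for x y :: 'a
    using assms by (simp add: mult_right_mono)
  ultimately show "F \<in> lipschitz_maps l C"
    unfolding lipschitz_maps_def using order_trans by blast
qed

lemma lipschitz_maps_value:
  assumes "F \<in> lipschitz_maps k C" "x \<in> C"
  shows "F x \<noteq> {}" "F x \<subseteq> C" "compact (F x)" "bounded (F x)"
  using assms by (auto simp: lipschitz_maps_def compact_subsets_def PiE_iff
      intro: compact_imp_bounded)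

lemma lipschitz_maps_hausdorff:
  assumes "F \<in> lipschitz_maps k C" "x \<in> C" "y \<in> C"
  shows "hausdorff_dist (F x) (F y) \<le> k * dist x y"
  using assms by (auto simp: lipschitz_maps_def)

lemmas nonexpansive_maps_value = lipschitz_maps_value[where k = 1, folded nonexpansive_maps_eq]

lemma hausdorff_le_unif_dist:
  assumes "bounded C" and F: "F \<in> nonexpansive_maps C" and G: "G \<in> nonexpansive_maps C"
    and x: "x \<in> C"
  shows "hausdorff_dist (F x) (G x) \<le> unif_dist C F G"
proof -
  obtain e where e: "\<And>x y. x \<in> C \<Longrightarrow> y \<in> C \<Longrightarrow> dist x y \<le> e"
    using assms(1) by (metis bounded_two_points)
  have "bdd_above ((\<lambda>x. hausdorff_dist (F x) (G x)) ` C)"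
  proof (rule bdd_aboveI2)
    fix y assume y: "y \<in> C"
    have "infdist a B \<le> e" if "a \<in> C" "B \<noteq> {}" "B \<subseteq> C" for a and B :: "'a set"
      using that e infdist_le2 by (metis ex_in_conv subsetD)
    then show "hausdorff_dist (F y) (G y) \<le> e"
      using nonexpansive_maps_value[OF F y] nonexpansive_maps_value[OF G y]
      by (intro hausdorff_dist_le) auto
  qed
  then show ?thesis
    using x F G by (auto simp: unif_dist_def intro: cSUP_upper)
qed

lemma unif_dist_le:
  assumes "C \<noteq> {}" "F \<in> nonexpansive_maps C" "G \<in> nonexpansive_maps C"
    "\<And>x. x \<in> C \<Longrightarrow> hausdorff_dist (F x) (G x) \<le> r"
  shows "unif_dist C F G \<le> r"
  using assms by (auto simp: unif_dist_def intro: cSUP_least)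

section \<open>Nearest points and pointwise images of set-valued mappings\<close>

lemma metric_proj_nonempty:
  assumes "compact K" "K \<noteq> {}"
  shows "metric_proj K x \<noteq> {}"
proof -
  have "continuous_on K (dist x)"
    by (intro continuous_on_dist continuous_on_const continuous_on_id)
  then obtain y where y: "y \<in> K" "\<forall>z\<in>K. dist x y \<le> dist x z"
    using continuous_attains_inf[OF assms] by blast
  then have "dist x y \<le> infdist x K"
    using assms by (simp add: infdist_notempty cINF_greatest)
  then have "y \<in> metric_proj K x"
    using y infdist_le[of y K x] by (simp add: metric_proj_def)
  then show ?thesis by blast
qed

text \<open>By compactness each point has a nearest partner in the other set, at distance at most
  \<open>hausdorff_dist A B\<close>; the images of the two partners are then compared. Exchanging
  \<open>A\<close> and \<open>B\<close> gives the other half.\<close>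

lemma hausdorff_dist_image_le:
  assumes "compact A" "compact B" "A \<noteq> {}" "B \<noteq> {}" "0 \<le> b"
    and "\<And>y z. y \<in> A \<Longrightarrow> z \<in> B \<Longrightarrow> dist (f y) (g z) \<le> a + b * dist y z"
  shows "hausdorff_dist (f ` A) (g ` B) \<le> a + b * hausdorff_dist A B"
proof -
  have *: "infdist (f' y) (g' ` B') \<le> a + b * hausdorff_dist A' B'"
    if A': "compact A'" "y \<in> A'" and B': "compact B'" "B' \<noteq> {}" and fg:
      "\<And>y z. y \<in> A' \<Longrightarrow> z \<in> B' \<Longrightarrow> dist (f' y) (g' z) \<le> a + b * dist y z" for A' B' f' g' y
  proof -
    obtain z where z: "z \<in> B'" "dist y z = infdist y B'"
      using metric_proj_nonempty[OF B', of y] by (auto simp: metric_proj_def)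
    have "dist y z \<le> hausdorff_dist A' B'"
      using infdist_le_hausdorff[of A' B' y] A' B' z compact_imp_bounded by metis
    then have "dist (f' y) (g' z) \<le> a + b * hausdorff_dist A' B'"
      using fg[OF A'(2) z(1)] assms(5) by (smt (verit) mult_left_mono)
    then show ?thesis
      using infdist_le2[of "g' z" "g' ` B'"] z(1) by blast
  qed
  show ?thesis
  proof (rule hausdorff_dist_le)
    show "infdist u (g ` B) \<le> a + b * hausdorff_dist A B" if u: "u \<in> f ` A" for u
    proof -
      obtain y where "y \<in> A" "u = f y" using u by blast
      then show ?thesis using *[of A y B f g] assms by simp
    qed
    show "infdist u (f ` A) \<le> a + b * hausdorff_dist A B" if u: "u \<in> g ` B" for u
    proof -
      obtain z where z: "z \<in> B" "u = g z" using u by blast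
      have "dist (g y) (f z) \<le> a + b * dist y z" if "y \<in> B" "z \<in> A" for y z
        using assms(6)[OF that(2,1)] by (simp add: dist_commute)
      then show ?thesis using *[of B z A g f] z assms by (simp add: hausdorff_dist_commute)
    qed
  qed (use assms in auto)
qed

text \<open>Both perturbations below move each value point \<open>y\<close> of \<open>F x\<close> to
  \<open>g x y\<close>. Here \<open>a\<close> is the cost of letting the displacement depend on the
  base point, and \<open>b\<close> acts on the variation of \<open>F\<close>.\<close>

lemma image_in_lipschitz_maps:
  fixes g :: "'a::metric_space \<Rightarrow> 'a \<Rightarrow> 'a"
  assumes F: "F \<in> lipschitz_maps k C" and "0 \<le> b"
    and gC: "\<And>x y. x \<in> C \<Longrightarrow> y \<in> C \<Longrightarrow> g x y \<in> C"
    and g: "\<And>x x' y y'. x \<in> C \<Longrightarrow> x' \<in> C \<Longrightarrow> y \<in> C \<Longrightarrow> y' \<in> C \<Longrightarrow>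
      dist (g x y) (g x' y') \<le> a * dist x x' + b * dist y y'"
  shows "(\<lambda>x\<in>C. g x ` F x) \<in> lipschitz_maps (a + b * k) C"
proof -
  note val = lipschitz_maps_value[OF F]
  have "compact (g x ` F x)" if x: "x \<in> C" for x
  proof (rule compact_continuous_image)
    have "b-lipschitz_on C (g x)"
      using g[OF x x] \<open>0 \<le> b\<close> by (auto intro: lipschitz_onI)
    then show "continuous_on (F x) (g x)"
      using lipschitz_on_continuous_on continuous_on_subset val[OF x] by blast
  qed (use val x in auto)
  then have "(\<lambda>x\<in>C. g x ` F x) \<in> C \<rightarrow>\<^sub>E compact_subsets C"
    using val gC by (fastforce simp: compact_subsets_def)
  moreover have "hausdorff_dist (g x ` F x) (g y ` F y) \<le> (a + b * k) * dist x y"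
    if xy: "x \<in> C" "y \<in> C" for x y
  proof -
    have "hausdorff_dist (g x ` F x) (g y ` F y)
        \<le> a * dist x y + b * hausdorff_dist (F x) (F y)"
      by (rule hausdorff_dist_image_le) (use val xy g \<open>0 \<le> b\<close> in \<open>auto simp: subset_iff\<close>)
    also have "\<dots> \<le> a * dist x y + b * (k * dist x y)"
      using lipschitz_maps_hausdorff[OF F xy] \<open>0 \<le> b\<close> by (simp add: mult_left_mono)
    finally show ?thesis by (simp add: algebra_simps)
  qed
  ultimately show ?thesis by (simp add: lipschitz_maps_def)
qed

lemma unif_dist_image_le:
  fixes g :: "'a::metric_space \<Rightarrow> 'a \<Rightarrow> 'a"
  assumes "C \<noteq> {}" and F: "F \<in> nonexpansive_maps C"
    and G: "(\<lambda>x\<in>C. g x ` F x) \<in> nonexpansive_maps C"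
    and g: "\<And>x y. x \<in> C \<Longrightarrow> y \<in> C \<Longrightarrow> dist y (g x y) \<le> c"
  shows "unif_dist C F (\<lambda>x\<in>C. g x ` F x) \<le> c"
proof (rule unif_dist_le[OF assms(1) F G])
  fix x assume x: "x \<in> C"
  note val = nonexpansive_maps_value[OF F x]
  have "hausdorff_dist (F x) (g x ` F x) \<le> c"
  proof (rule hausdorff_dist_le)
    show "infdist a (g x ` F x) \<le> c" if "a \<in> F x" for a
      using g[OF x, of a] val that by (intro infdist_le2[of "g x a"]) auto
    show "infdist b (F x) \<le> c" if b: "b \<in> g x ` F x" for b
    proof -
      obtain a where "a \<in> F x" "b = g x a" using b by blast
      then show ?thesis
        using g[OF x, of a] val by (intro infdist_le2[of a]) (auto simp: dist_commute)
    qed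
  qed (use val in auto)
  then show "hausdorff_dist (F x) ((\<lambda>x\<in>C. g x ` F x) x) \<le> c"
    using x by simp
qed

section \<open>Perturbing a mapping by moving its values along segments\<close>

lemma bounded_pos_dist:
  assumes "bounded C"
  obtains D where "0 < D" "\<And>x y. x \<in> C \<Longrightarrow> y \<in> C \<Longrightarrow> dist x y \<le> D"
proof -
  obtain e where "\<And>x y. x \<in> C \<Longrightarrow> y \<in> C \<Longrightarrow> dist x y \<le> e"
    using assms by (metis bounded_two_points)
  then show thesis using that[of "max e 1"] by (simp add: le_max_iff_disj)
qed

text \<open>The difference splits into a contraction by 1 - s and an error due to the changing
  coefficient. Only the first matters for a constant coefficient; the second is what a bump
  costs.\<close>

lemma dist_convex_combination_le:
  fixes y y' z :: "'a::real_normed_vector"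
  assumes "0 \<le> s" "s \<le> 1"
  shows "dist (y + s *\<^sub>R (z - y)) (y' + s' *\<^sub>R (z - y')) \<le> dist y y' * (1 - s) + \<bar>s - s'\<bar> * dist z y'"
proof -
  have "(y + s *\<^sub>R (z - y)) - (y' + s' *\<^sub>R (z - y')) = (1 - s) *\<^sub>R (y - y') + (s - s') *\<^sub>R (z - y')"
    by (simp add: algebra_simps)
  then show ?thesis
    using assms norm_triangle_ineq[of "(1 - s) *\<^sub>R (y - y')" "(s - s') *\<^sub>R (z - y')"]
    by (simp add: dist_norm mult.commute)
qed

lemma convex_combination_mem:
  fixes y z :: "'a::real_vector"
  assumes "convex C" "y \<in> C" "z \<in> C" "0 \<le> s" "s \<le> 1"
  shows "y + s *\<^sub>R (z - y) \<in> C"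
proof -
  have "(1 - s) *\<^sub>R y + s *\<^sub>R z \<in> C"
    using assms by (intro convexD) auto
  then show ?thesis by (simp add: algebra_simps)
qed

text \<open>Pulling all values towards one fixed point \<open>z\<close> of \<open>C\<close> by a
  fraction \<open>s\<close> contracts distances by 1 - s and moves no point further than s times the
  diameter bound.\<close>

lemma contraction_approx:
  fixes C :: "'a::real_normed_vector set"
  assumes "C \<noteq> {}" "convex C" "bounded C" and F: "F \<in> nonexpansive_maps C" and "0 < e"
  obtains k G where "k < 1" "G \<in> lipschitz_maps k C" "unif_dist C F G < e"
proof -
  obtain z where z: "z \<in> C" using assms(1) by blast
  obtain D where D: "0 < D" "\<And>x y. x \<in> C \<Longrightarrow> y \<in> C \<Longrightarrow> dist x y \<le> D"
    using bounded_pos_dist[OF assms(3)] by blast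
  define s where "s = min (1/2) (e / (2 * D))"
  have s: "0 < s" "s \<le> 1" "s * D < e"
  proof -
    show "0 < s" "s \<le> 1" using D \<open>0 < e\<close> by (auto simp: s_def)
    have "s * D \<le> e / (2 * D) * D" using D by (intro mult_right_mono) (auto simp: s_def)
    then show "s * D < e" using D \<open>0 < e\<close> by simp
  qed
  define g where "g = (\<lambda>(x::'a) y. y + s *\<^sub>R (z - y))"
  define G where "G = (\<lambda>x\<in>C. g x ` F x)"
  have "G \<in> lipschitz_maps (0 + (1 - s) * 1) C"
    unfolding G_def
  proof (rule image_in_lipschitz_maps)
    show "F \<in> lipschitz_maps 1 C" using F by (simp add: nonexpansive_maps_eq)
    show "g x y \<in> C" if "y \<in> C" for x y
      using convex_combination_mem[OF assms(2) that z, of s] s by (simp add: g_def)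
    show "dist (g x y) (g x' y') \<le> 0 * dist x x' + (1 - s) * dist y y'" for x x' y y'
      using dist_convex_combination_le[of s y z y' s] s by (simp add: g_def mult.commute)
  qed (use s in auto)
  then have G: "G \<in> lipschitz_maps (1 - s) C" by simp
  then have "G \<in> nonexpansive_maps C"
    using lipschitz_maps_mono[of "1 - s" 1 C] s by (auto simp: nonexpansive_maps_eq)
  moreover have "dist y (g x y) \<le> s * D" if "y \<in> C" for x y
    using D(2)[OF z that] s by (simp add: g_def dist_norm mult_left_mono)
  ultimately have "unif_dist C F G \<le> s * D"
    unfolding G_def using unif_dist_image_le[OF assms(1) F] by blast
  then show thesis
    using that[of "1 - s" G] G s by simp
qed

text \<open>One nearest point \<open>w\<close> of \<open>F p\<close> is pulled towards
  \<open>p\<close> by the fraction \<open>m\<close>, every other point of \<open>F p\<close> by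
  strictly less, so the image of \<open>w\<close> becomes the only nearest point. The pull vanishes
  for base points at distance at least \<open>r\<close> from \<open>p\<close>, hence on
  \<open>Z\<close>.\<close>

lemma unique_projection_approx:
  fixes C :: "'a::real_normed_vector set"
  assumes "C \<noteq> {}" "convex C" "bounded C" and k: "k < 1" and F: "F \<in> lipschitz_maps k C"
    and p: "p \<in> C" and "0 < e" and Z: "finite Z" "p \<notin> Z"
  obtains l G q where "l < 1" "G \<in> lipschitz_maps l C" "unif_dist C F G < e"
    "metric_proj (G p) p = {q}" "\<And>z. z \<in> Z \<Longrightarrow> G z = F z"
proof -
  obtain D where D: "0 < D" "\<And>x y. x \<in> C \<Longrightarrow> y \<in> C \<Longrightarrow> dist x y \<le> D"
    using bounded_pos_dist[OF assms(3)] by blast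
  obtain r where r: "0 < r" "\<And>z. z \<in> Z \<Longrightarrow> r \<le> dist z p"
    using finite_set_avoid[OF Z(1), of p] Z(2) by (metis dist_commute)
  note val = lipschitz_maps_value[OF F]
  obtain w where w: "w \<in> F p" "dist p w = infdist p (F p)"
    using metric_proj_nonempty[of "F p" p] val[OF p] by (auto simp: metric_proj_def)
  \<comment> \<open>The entries serve, in order, to keep 1 - \<open>\<sigma>\<close> positive, to
    keep displacements below \<open>e\<close>, and to bound the Lipschitz cost \<open>c\<close> by
    (1 - k)/4.\<close>
  define m where "m = Min {1/2, e / (2 * D), (1 - k) * r / (4 * D)}"
  have m: "0 < m" "m \<le> 1/2" "m * D < e" "4 * (m * D / r) \<le> 1 - k"
  proof -
    show "0 < m" "m \<le> 1/2" using D r k \<open>0 < e\<close> by (auto simp: m_def)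
    have "m * D \<le> e / (2 * D) * D" using D by (intro mult_right_mono) (auto simp: m_def)
    then show "m * D < e" using D \<open>0 < e\<close> by simp
    have "m * D \<le> (1 - k) * r / (4 * D) * D"
      using D by (intro mult_right_mono) (auto simp: m_def)
    then have "m * D \<le> (1 - k) * r / 4" using D by simp
    then show "4 * (m * D / r) \<le> 1 - k" using r by (simp add: field_simps)
  qed
  \<comment> \<open>A tent function on pairs with peak value \<open>m\<close> attained only at (p,
    w).\<close>
  define \<sigma> where "\<sigma> = (\<lambda>x y. m * max 0 (1 - (dist x p + dist y w) / r))"
  define g where "g = (\<lambda>x y. y + \<sigma> x y *\<^sub>R (p - y))"
  define G where "G = (\<lambda>x\<in>C. g x ` F x)"
  define c where "c = m * D / r"
  have c: "0 < c" using m D r by (simp add: c_def)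
  have \<sigma>_ge: "0 \<le> \<sigma> x y" for x y using m by (simp add: \<sigma>_def)
  have \<sigma>_le: "\<sigma> x y \<le> m" for x y
    using m r mult_left_mono[of "max 0 (1 - (dist x p + dist y w) / r)" 1 m] by (simp add: \<sigma>_def)
  have \<sigma>_less: "\<sigma> x y < m" if "y \<noteq> w" for x y
  proof -
    have "max 0 (1 - (dist x p + dist y w) / r) < 1"
      using r that by (simp add: add_nonneg_pos)
    then show ?thesis using m by (simp add: \<sigma>_def)
  qed
  \<comment> \<open>The factor \<open>D\<close> is included because a change of the coefficient acts
    on the segment from \<open>y'\<close> to \<open>p\<close>, of length at most
    \<open>D\<close>.\<close>
  have \<sigma>_lip: "\<bar>\<sigma> x y - \<sigma> x' y'\<bar> * D \<le> c * (dist x x' + dist y y')" for x y x' y'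
  proof -
    let ?u = "(dist x p + dist y w) / r" and ?v = "(dist x' p + dist y' w) / r"
    have "\<bar>?u - ?v\<bar> = \<bar>(dist x p - dist x' p) + (dist y w - dist y' w)\<bar> / r"
      using r by (simp add: diff_divide_distrib[symmetric] algebra_simps)
    also have "\<dots> \<le> (dist x x' + dist y y') / r"
      using r abs_dist_diff_le[of x p x'] abs_dist_diff_le[of y w y']
      by (intro divide_right_mono) (auto simp: dist_commute)
    finally have "\<bar>max 0 (1 - ?u) - max 0 (1 - ?v)\<bar> \<le> (dist x x' + dist y y') / r"
      by linarith
    then have "m * \<bar>max 0 (1 - ?u) - max 0 (1 - ?v)\<bar> * D \<le> m * ((dist x x' + dist y y') / r) * D"
      using m D by (intro mult_right_mono mult_left_mono) auto
    moreover have "\<bar>\<sigma> x y - \<sigma> x' y'\<bar> = m * \<bar>max 0 (1 - ?u) - max 0 (1 - ?v)\<bar>"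
      using m by (simp add: \<sigma>_def right_diff_distrib[symmetric] abs_mult)
    ultimately show ?thesis by (simp add: c_def field_simps)
  qed
  have "G \<in> lipschitz_maps (c + (1 + c) * k) C"
    unfolding G_def
  proof (rule image_in_lipschitz_maps[OF F])
    show "g x y \<in> C" if "y \<in> C" for x y
      using convex_combination_mem[OF assms(2) that p, of "\<sigma> x y"] \<sigma>_ge \<sigma>_le[of x y] m
      by (auto simp: g_def)
    show "dist (g x y) (g x' y') \<le> c * dist x x' + (1 + c) * dist y y'"
      if "x \<in> C" "x' \<in> C" "y \<in> C" "y' \<in> C" for x x' y y'
    proof -
      have "dist (g x y) (g x' y') \<le> dist y y' * (1 - \<sigma> x y) + \<bar>\<sigma> x y - \<sigma> x' y'\<bar> * dist p y'"
        unfolding g_def using \<sigma>_ge \<sigma>_le[of x y] m by (intro dist_convex_combination_le) auto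
      also have "\<dots> \<le> dist y y' * 1 + \<bar>\<sigma> x y - \<sigma> x' y'\<bar> * D"
        using \<sigma>_ge D(2)[OF p that(4)] by (intro add_mono mult_left_mono) auto
      also have "\<dots> \<le> c * dist x x' + (1 + c) * dist y y'"
        using \<sigma>_lip[of x y x' y'] by (simp add: algebra_simps)
      finally show ?thesis .
    qed
  qed (use c in auto)
  \<comment> \<open>The new constant is at most k + 2c, and 2c is at most (1 - k)/2.\<close>
  moreover have l: "c + (1 + c) * k < 1"
  proof -
    have "c * k \<le> c" using c k by simp
    moreover have "4 * c \<le> 1 - k" using m by (simp add: c_def)
    moreover have "c + (1 + c) * k = c + k + c * k" by (simp add: algebra_simps)
    ultimately show ?thesis using c by linarith
  qed
  moreover have "unif_dist C F G < e"
  proof -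
    have "dist y (g x y) \<le> m * D" if "y \<in> C" for x y
    proof -
      have "dist y (g x y) = \<sigma> x y * dist p y"
        using \<sigma>_ge by (simp add: g_def dist_norm)
      also have "\<dots> \<le> m * D"
        using \<sigma>_ge \<sigma>_le m D(2)[OF p that] by (intro mult_mono) auto
      finally show ?thesis .
    qed
    moreover have "F \<in> nonexpansive_maps C" "G \<in> nonexpansive_maps C"
      using lipschitz_maps_mono[of k 1 C] lipschitz_maps_mono[of "c + (1 + c) * k" 1 C]
        F k \<open>G \<in> _\<close> l by (auto simp: nonexpansive_maps_eq)
    ultimately have "unif_dist C F G \<le> m * D"
      unfolding G_def using unif_dist_image_le[OF assms(1)] by blast
    then show ?thesis using m by simp
  qed
  moreover have "metric_proj (G p) p = {g p w}"
  proof -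
    have dist_g: "dist p (g p y) = (1 - \<sigma> p y) * dist p y" for y
    proof -
      have "p - g p y = (1 - \<sigma> p y) *\<^sub>R (p - y)" by (simp add: g_def algebra_simps)
      then show ?thesis using \<sigma>_le[of p y] m by (simp add: dist_norm)
    qed
    have \<sigma>_w: "\<sigma> p w = m" by (simp add: \<sigma>_def)
    have w_le: "dist p w \<le> dist p y" if "y \<in> F p" for y
      using w(2) infdist_le[OF that] by simp
    have le: "dist p (g p w) \<le> dist p (g p y)" if "y \<in> F p" for y
      unfolding dist_g \<sigma>_w using w_le[OF that] \<sigma>_le[of p y] m by (intro mult_mono) auto
    \<comment> \<open>If \<open>p\<close> = \<open>w\<close>, the strict inequality of the
      coefficients is lost on multiplying by zero; then \<open>y\<close> differs from
      \<open>p\<close> and its image stays at positive distance from \<open>p\<close>.\<close>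
    have less: "dist p (g p w) < dist p (g p y)" if "y \<in> F p" "y \<noteq> w" for y
    proof (cases "dist p w = 0")
      case True
      then have "p \<noteq> y" using that by auto
      then have "0 < (1 - \<sigma> p y) * dist p y"
        using \<sigma>_le[of p y] m by (intro mult_pos_pos) auto
      then show ?thesis unfolding dist_g True by simp
    next
      case False
      then have "(1 - m) * dist p w < (1 - \<sigma> p y) * dist p w"
        using \<sigma>_less[OF that(2), of p] by simp
      also have "\<dots> \<le> (1 - \<sigma> p y) * dist p y"
        using w_le[OF that(1)] \<sigma>_le[of p y] m by (intro mult_left_mono) auto
      finally show ?thesis by (simp add: dist_g \<sigma>_w)
    qed
    have Gp: "G p = g p ` F p" using p by (simp add: G_def)
    have "infdist p (G p) = dist p (g p w)"
    proof (rule antisym)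
      show "infdist p (G p) \<le> dist p (g p w)" using w Gp by (intro infdist_le) auto
      show "dist p (g p w) \<le> infdist p (G p)"
        unfolding Gp using w le
        by (subst infdist_notempty) (auto intro!: cINF_greatest)
    qed
    then show ?thesis
      using w less by (fastforce simp: metric_proj_def Gp)
  qed
  moreover have "G z = F z" if z: "z \<in> Z" for z
  proof (cases "z \<in> C")
    case True
    have "\<sigma> z y = 0" for y
    proof -
      have "r \<le> dist z p + dist y w" using r(2)[OF z] by (smt (verit) zero_le_dist)
      then show ?thesis using r(1) by (simp add: \<sigma>_def)
    qed
    then show ?thesis using True by (simp add: G_def g_def)
  next
    case False
    \<comment> \<open>\<open>Z\<close> may leave \<open>C\<close>; there both mappings take the
      value \<open>undefined\<close>.\<close>
    have "F \<in> C \<rightarrow>\<^sub>E compact_subsets C" using F by (simp add: lipschitz_maps_def)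
    then have "F z = undefined" using False by (rule PiE_arb)
    then show ?thesis using False by (simp add: G_def)
  qed
  ultimately show thesis using that by blast
qed

section \<open>Finite trajectories\<close>

text \<open>This is the set R_n(F, x) of the outline, with all choices of nearest points followed at
  once.\<close>

primrec reach :: "('a::metric_space \<Rightarrow> 'a set) \<Rightarrow> 'a \<Rightarrow> nat \<Rightarrow> 'a set" where
  "reach F x 0 = {x}"
| "reach F x (Suc n) = (\<Union>y\<in>reach F x n. metric_proj (F y) y)"

lemma reach_subset:
  assumes "F \<in> nonexpansive_maps C" "x \<in> C"
  shows "reach F x n \<subseteq> C"
  by (induction n)
    (use assms nonexpansive_maps_value(2)[OF assms(1)] in \<open>auto simp: metric_proj_def subset_iff\<close>)

lemma reach_nonempty:
  assumes "F \<in> nonexpansive_maps C" "x \<in> C"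
  shows "reach F x n \<noteq> {}"
proof (induction n)
  case (Suc n)
  then obtain y where y: "y \<in> reach F x n" by blast
  then have "y \<in> C" using reach_subset assms by blast
  then have "metric_proj (F y) y \<noteq> {}"
    using metric_proj_nonempty nonexpansive_maps_value assms(1) by metis
  then show ?case using y by auto
qed simp

text \<open>Points chosen independently from the successive sets fit together: the projection set at
  \<open>xs n\<close> is nonempty and lies in the next set, whose only element is
  \<open>xs (Suc n)\<close>.\<close>

lemma regular_trajectory_if_reach_unique:
  assumes F: "F \<in> nonexpansive_maps C" and x: "x \<in> C"
    and unique: "\<And>n u v. u \<in> reach F x n \<Longrightarrow> v \<in> reach F x n \<Longrightarrow> u = v"
  shows "\<exists>xs. regular_trajectory C F x xs"
proof -
  define xs where "xs n = (SOME u. u \<in> reach F x n)" for n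
  have xs: "xs n \<in> reach F x n" for n
    using reach_nonempty[OF F x] by (auto simp: xs_def some_in_eq)
  have C: "xs n \<in> C" for n
    using xs reach_subset[OF F x] by blast
  have "metric_proj (F (xs n)) (xs n) = {xs (Suc n)}" for n
  proof -
    have "metric_proj (F (xs n)) (xs n) \<subseteq> reach F x (Suc n)" using xs by auto
    moreover have "metric_proj (F (xs n)) (xs n) \<noteq> {}"
      using metric_proj_nonempty nonexpansive_maps_value F C by metis
    ultimately show ?thesis
      using unique[of _ "Suc n"] xs[of "Suc n"] by blast
  qed
  moreover have "xs 0 = x" using xs[of 0] by simp
  ultimately have "regular_trajectory C F x xs"
    using C by (simp add: regular_trajectory_def trajectory_def)
  then show ?thesis by blast
qed

text \<open>A nearest point of \<open>L\<close> to \<open>p'\<close> is close to some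
  \<open>w\<close> in \<open>K\<close> that is almost nearest to \<open>p\<close>. Compactness of
  \<open>K\<close> and uniqueness of \<open>q\<close> force such a \<open>w\<close> to be close to
  \<open>q\<close>.\<close>

lemma unique_projection_usc:
  fixes K :: "'a::metric_space set"
  assumes K: "compact K" and q: "metric_proj K p = {q}" and "0 < e"
  obtains d where "0 < d" "\<And>L p' u. \<lbrakk>compact L; L \<noteq> {}; hausdorff_dist K L < d; dist p p' < d;
    u \<in> metric_proj L p'\<rbrakk> \<Longrightarrow> dist q u < e"
proof -
  have qK: "q \<in> K" "dist p q = infdist p K" using q by (auto simp: metric_proj_def)
  \<comment> \<open>The gap \<open>h\<close>: the points of \<open>K\<close> outside the ball about
    \<open>q\<close> form a compact set, on which the distance to \<open>p\<close> has a minimum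
    exceeding \<open>dist p q\<close>.\<close>
  obtain h where h: "0 < h" "\<And>w. w \<in> K \<Longrightarrow> dist p w < dist p q + h \<Longrightarrow> dist q w < e / 2"
  proof (cases "K - ball q (e / 2) = {}")
    case True
    then have "dist q w < e / 2" if "w \<in> K" for w
      using that by (metis Diff_eq_empty_iff mem_ball subsetD)
    then show thesis using that[of 1] by simp
  next
    case False
    have "continuous_on (K - ball q (e / 2)) (dist p)"
      by (intro continuous_on_dist continuous_on_const continuous_on_id)
    then obtain v where v': "v \<in> K - ball q (e / 2)" "\<forall>w\<in>K - ball q (e / 2). dist p v \<le> dist p w"
      using continuous_attains_inf[OF compact_diff[OF K open_ball] False] by blast
    have v: "v \<in> K" "e / 2 \<le> dist q v"
      "\<And>w. w \<in> K \<Longrightarrow> e / 2 \<le> dist q w \<Longrightarrow> dist p v \<le> dist p w"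
      using v' by auto
    have "v \<noteq> q" using v \<open>0 < e\<close> by auto
    then have "v \<notin> metric_proj K p" using q by auto
    then have "dist p q < dist p v"
      using v(1) qK infdist_le[OF v(1), of p] by (auto simp: metric_proj_def)
    then show thesis using that[of "dist p v - dist p q"] v(3) by force
  qed
  \<comment> \<open>The comparison of \<open>dist p w\<close> with \<open>dist p q\<close> below
    uses four errors, each less than \<open>d\<close>.\<close>
  define d where "d = min (e / 2) (h / 4)"
  show thesis
  proof
    show "0 < d" using \<open>0 < e\<close> h by (simp add: d_def)
    fix L p' u
    assume L: "compact L" "L \<noteq> {}" "hausdorff_dist K L < d" "dist p p' < d"
      and u: "u \<in> metric_proj L p'"
    have u': "u \<in> L" "dist p' u = infdist p' L" using u by (auto simp: metric_proj_def)
    have near: "\<exists>b\<in>B. dist a b < d"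
      if AB: "compact A" "compact B" "B \<noteq> {}" "a \<in> A" "hausdorff_dist A B < d" for A B :: "'a set" and a
    proof -
      obtain b where "b \<in> B" "dist a b = infdist a B"
        using metric_proj_nonempty[OF AB(2,3), of a] by (auto simp: metric_proj_def)
      then show ?thesis
        using infdist_le_hausdorff[of A B a] AB compact_imp_bounded
        by (metis le_less_trans)
    qed
    obtain w where w: "w \<in> K" "dist u w < d"
      using near[of L K u] L u' K qK by (auto simp: hausdorff_dist_commute)
    obtain v where v: "v \<in> L" "dist q v < d"
      using near[of K L q] L K qK by auto
    have "dist p w \<le> dist p p' + dist p' u + dist u w"
      using dist_triangle[of p w p'] dist_triangle[of p' w u] by linarith
    moreover have "dist p' u \<le> dist p' v" using u' infdist_le[OF v(1)] by simp
    moreover have "dist p' v \<le> dist p p' + dist p q + dist q v"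
      using dist_triangle[of p' v p] dist_triangle[of p v q] by (simp add: dist_commute)
    ultimately have "dist p w < dist p q + h"
      using L w v by (simp add: d_def)
    then have "dist q w < e / 2" using h w by blast
    then show "dist q u < e"
      using w dist_triangle[of q u w] by (simp add: d_def dist_commute)
  qed
qed

text \<open>Induction along the trajectory. The distance from \<open>F (y n)\<close> to
  \<open>G v\<close> is at most the distance of the mappings plus the drift from \<open>y n\<close>
  to \<open>v\<close>, since \<open>G\<close> is nonexpansive; each part is kept below d/2.\<close>

lemma reach_usc:
  assumes "bounded C" and F: "F \<in> nonexpansive_maps C"
    and y: "\<And>i. y i \<in> C" "\<And>i. i < n \<Longrightarrow> metric_proj (F (y i)) (y i) = {y (Suc i)}" and "0 < e"
  shows "\<exists>d>0. \<forall>G\<in>nonexpansive_maps C. \<forall>x\<in>C. unif_dist C F G < d \<longrightarrow> dist (y 0) x < d \<longrightarrow>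
    (\<forall>u\<in>reach G x n. dist (y n) u < e)"
  using y(2) \<open>0 < e\<close>
proof (induction n arbitrary: e)
  case 0
  then show ?case by auto
next
  case (Suc n)
  note val = nonexpansive_maps_value
  obtain d where d: "0 < d" "\<And>L p' u. \<lbrakk>compact L; L \<noteq> {}; hausdorff_dist (F (y n)) L < d;
      dist (y n) p' < d; u \<in> metric_proj L p'\<rbrakk> \<Longrightarrow> dist (y (Suc n)) u < e"
    using unique_projection_usc[OF val(3)[OF F y(1)] Suc.prems(1)[of n] Suc.prems(2)] by auto
  obtain d' where d': "0 < d'" "\<And>G x u. \<lbrakk>G \<in> nonexpansive_maps C; x \<in> C; unif_dist C F G < d';
      dist (y 0) x < d'; u \<in> reach G x n\<rbrakk> \<Longrightarrow> dist (y n) u < d / 2"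
    using Suc.IH[of "d / 2"] Suc.prems(1) d(1) by auto
  show ?case
  proof (intro exI conjI ballI impI)
    show "0 < min d' (d / 2)" using d d' by simp
    fix G x u
    assume G: "G \<in> nonexpansive_maps C" and x: "x \<in> C" and dG: "unif_dist C F G < min d' (d / 2)"
      and dx: "dist (y 0) x < min d' (d / 2)" and u: "u \<in> reach G x (Suc n)"
    obtain v where v: "v \<in> reach G x n" "u \<in> metric_proj (G v) v" using u by auto
    have vC: "v \<in> C" using v reach_subset[OF G x] by blast
    have dv: "dist (y n) v < d / 2" using d'(2)[OF G x] dG dx v by simp
    have "hausdorff_dist (F (y n)) (G v)
        \<le> hausdorff_dist (F (y n)) (G (y n)) + hausdorff_dist (G (y n)) (G v)"
      using val[OF F y(1)] val[OF G y(1)] val[OF G vC] by (intro hausdorff_dist_triangle)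
    also have "\<dots> \<le> unif_dist C F G + dist (y n) v"
      using hausdorff_le_unif_dist[OF assms(1) F G y(1)] G y(1) vC
      by (intro add_mono) (simp_all add: nonexpansive_maps_def)
    finally have "hausdorff_dist (F (y n)) (G v) < d" using dG dv by simp
    then show "dist (y (Suc n)) u < e"
      using d(2)[OF val(3)[OF G vC] val(1)[OF G vC] _ _ v(2)] dv d(1) by simp
  qed
qed

text \<open>One more point is made regular per step, spending half of the allowed error. The mapping
  stays a strict contraction, so slack remains, and its values at earlier points are untouched, so
  their unique projections survive.\<close>

lemma regular_start_approx:
  fixes C :: "'a::real_normed_vector set"
  assumes "C \<noteq> {}" "convex C" "bounded C" and "k < 1" and F: "F \<in> lipschitz_maps k C"
    and x: "x \<in> C" and "0 < e"
  shows "\<exists>l<1. \<exists>G\<in>lipschitz_maps l C. \<exists>y. unif_dist C F G < e \<and> y 0 = x \<and> (\<forall>i. y i \<in> C) \<and>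
    (\<forall>i<n. metric_proj (G (y i)) (y i) = {y (Suc i)})"
  using \<open>0 < e\<close>
proof (induction n arbitrary: e)
  case 0
  have F1: "F \<in> nonexpansive_maps C"
    using F \<open>k < 1\<close> lipschitz_maps_mono[of k 1 C] by (auto simp: nonexpansive_maps_eq)
  have "unif_dist C F F = 0"
    using Metric_space.mdist_zero[OF Metric_space_nonexpansive_maps[OF assms(1,3)] F1] .
  then show ?case
    using F \<open>k < 1\<close> x 0 by (intro exI[of _ k] conjI bexI[of _ F] exI[of _ "\<lambda>_. x"]) auto
next
  case (Suc n)
  interpret Metric_space "nonexpansive_maps C" "unif_dist C"
    using assms by (intro Metric_space_nonexpansive_maps)
  have sub: "G \<in> nonexpansive_maps C" if "G \<in> lipschitz_maps l C" "l < 1" for G l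
    using that lipschitz_maps_mono[of l 1 C] by (auto simp: nonexpansive_maps_eq)
  obtain l G y where G: "l < 1" "G \<in> lipschitz_maps l C" "unif_dist C F G < e / 2" and
    y: "y 0 = x" "\<And>i. y i \<in> C" "\<And>i. i < n \<Longrightarrow> metric_proj (G (y i)) (y i) = {y (Suc i)}"
    using Suc.IH[of "e / 2"] Suc.prems by auto
  \<comment> \<open>Entries of \<open>y\<close> after index \<open>n\<close> are mere placeholders
    in \<open>C\<close>, so entry \<open>Suc n\<close> may be overwritten by the new
    projection.\<close>
  have extend: ?case
    if "l' < 1" "G' \<in> lipschitz_maps l' C" "unif_dist C F G' < e"
      "metric_proj (G' (y n)) (y n) = {q}" "\<And>i. i < n \<Longrightarrow> G' (y i) = G (y i)" for l' G' q
  proof -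
    have "q \<in> C"
      using that(4) lipschitz_maps_value(2)[OF that(2) y(2)] by (auto simp: metric_proj_def)
    then show ?thesis
      using that y
      by (intro exI[of _ l'] conjI bexI[of _ G'] exI[of _ "y(Suc n := q)"]) (auto simp: less_Suc_eq)
  qed
  \<comment> \<open>If \<open>y n\<close> was visited before, its projection is already unique and
    \<open>G\<close> is kept; otherwise the earlier points can serve as the set \<open>Z\<close> to
    be avoided.\<close>
  show ?case
  proof (cases "\<exists>i<n. y n = y i")
    case True
    then show ?thesis
      using extend[of l G] G y Suc.prems by fastforce
  next
    case False
    then have "y n \<notin> y ` {..<n}" by auto
    then obtain l' G' q where G': "l' < 1" "G' \<in> lipschitz_maps l' C" "unif_dist C G G' < e / 2"
      "metric_proj (G' (y n)) (y n) = {q}" "\<And>z. z \<in> y ` {..<n} \<Longrightarrow> G' z = G z"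
      using unique_projection_approx[OF assms(1-3) G(1,2) y(2), of "e / 2" "y ` {..<n}" n]
        Suc.prems by (metis finite_imageI finite_lessThan half_gt_zero)
    have "unif_dist C F G' < e"
      using triangle[of F G G'] sub F \<open>k < 1\<close> G G' by fastforce
    then show ?thesis using extend[OF G'(1,2)] G' by auto
  qed
qed

section \<open>Generic regularity\<close>

text \<open>Robustness in both the mapping and the start is built in to make the condition open; the
  radius is an explicit argument so that it can be halved.\<close>

definition stably_narrow :: "'a::metric_space set \<Rightarrow> nat \<Rightarrow> real \<Rightarrow> ('a \<Rightarrow> 'a set) \<Rightarrow> 'a \<Rightarrow> real \<Rightarrow> bool"
  where "stably_narrow C n e F x d \<longleftrightarrow> 0 < d \<and>
    (\<forall>G\<in>nonexpansive_maps C. \<forall>x'\<in>C. unif_dist C F G < d \<longrightarrow> dist x x' < d \<longrightarrow>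
      (\<forall>u\<in>reach G x' n. \<forall>v\<in>reach G x' n. dist u v < e))"

lemma stably_narrow_nearby:
  assumes "C \<noteq> {}" "bounded C" and "stably_narrow C n e F x d"
    and "F \<in> nonexpansive_maps C" "G \<in> nonexpansive_maps C" "unif_dist C F G < d / 2"
    and "dist x x' < d / 2"
  shows "stably_narrow C n e G x' (d / 2)"
proof -
  interpret Metric_space "nonexpansive_maps C" "unif_dist C"
    using assms by (intro Metric_space_nonexpansive_maps)
  have "unif_dist C F H < d" if "H \<in> nonexpansive_maps C" "unif_dist C G H < d / 2" for H
    using triangle[OF assms(4,5) that(1)] that(2) assms(6) by simp
  moreover have "dist x z < d" if "dist x' z < d / 2" for z
    using dist_triangle[of x z x'] that assms(7) by simp
  ultimately show ?thesis
    using assms(3) by (auto simp: stably_narrow_def)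
qed

text \<open>Only the mapping is perturbed, first to a contraction and then to one with a regular
  initial segment from the given \<open>x\<close>; \<open>reach_usc\<close> makes the outcome
  stable.\<close>

lemma stably_narrow_dense:
  fixes C :: "'a::real_normed_vector set"
  assumes C: "C \<noteq> {}" "convex C" "bounded C" and F: "F \<in> nonexpansive_maps C" and x: "x \<in> C"
    and "0 < e" "0 < r"
  shows "\<exists>G\<in>nonexpansive_maps C. unif_dist C F G < r \<and> (\<exists>d. stably_narrow C n e G x d)"
proof -
  interpret Metric_space "nonexpansive_maps C" "unif_dist C"
    using assms by (intro Metric_space_nonexpansive_maps)
  obtain k H where H: "k < 1" "H \<in> lipschitz_maps k C" "unif_dist C F H < r / 2"
    using contraction_approx[OF C F, of "r / 2"] \<open>0 < r\<close> by auto
  obtain l G y where G: "l < 1" "G \<in> lipschitz_maps l C" "unif_dist C H G < r / 2" and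
    y: "y 0 = x" "\<And>i. y i \<in> C" "\<And>i. i < n \<Longrightarrow> metric_proj (G (y i)) (y i) = {y (Suc i)}"
    using regular_start_approx[OF C H(1,2) x, of "r / 2" n] \<open>0 < r\<close> by auto
  have mem: "H \<in> nonexpansive_maps C" "G \<in> nonexpansive_maps C"
    using H G lipschitz_maps_mono[of k 1 C] lipschitz_maps_mono[of l 1 C]
    by (auto simp: nonexpansive_maps_eq)
  obtain d where d: "0 < d" "\<And>G' x' u. \<lbrakk>G' \<in> nonexpansive_maps C; x' \<in> C; unif_dist C G G' < d;
      dist x x' < d; u \<in> reach G' x' n\<rbrakk> \<Longrightarrow> dist (y n) u < e / 2"
    using reach_usc[of C G y n "e / 2"] C(3) mem(2) y \<open>0 < e\<close> by auto
  have "dist u v < e" if "dist (y n) u < e / 2" "dist (y n) v < e / 2" for u v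
    using dist_triangle[of u v "y n"] that by (simp add: dist_commute)
  then have "stably_narrow C n e G x d"
    using d unfolding stably_narrow_def by blast
  moreover have "unif_dist C F G < r"
    using triangle[OF F mem] H G by simp
  ultimately show ?thesis using mem by blast
qed

theorem theorem5p5:
  fixes C :: "'a::banach set"
  assumes "separable_space (euclidean :: 'a topology)"
    and "C \<noteq> {}" and "closed C" and "convex C" and "bounded C"
  shows "\<exists>\<F>. residual_in (Metric_space.mtopology (nonexpansive_maps C) (unif_dist C)) \<F> \<and>
           (\<forall>F\<in>\<F>. \<exists>U. residual_in (top_of_set C) U \<and>
              (\<forall>x0\<in>U. \<exists>x. regular_trajectory C F x0 x))"
proof -
  let ?M = "nonexpansive_maps C" and ?\<rho> = "unif_dist C"
  interpret Metric_space ?M ?\<rho>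
    using assms by (intro Metric_space_nonexpansive_maps)
  obtain S :: "'a set" where S: "countable S" "closure S = UNIV"
    using assms(1) by (auto simp: separable_space_def)
  then have "S \<noteq> {}" by auto
  define s where "s = from_nat_into S"
  have s: "\<exists>j. dist (s j) x < r" if r: "0 < r" for x r
  proof -
    have "x \<in> closure S" using S by simp
    then obtain z where z: "z \<in> S" "dist z x < r"
      using r unfolding closure_approachable by blast
    then obtain j where "s j = z"
      using from_nat_into_surj[OF S(1) z(1)] unfolding s_def by blast
    then show ?thesis using z by blast
  qed
  define e where "e k = 1 / real (Suc k)" for k
  have e: "0 < e k" for k by (simp add: e_def)
  \<comment> \<open>These countably many cells form a base for the topology of \<open>C\<close>.
    Their centres are dense in the whole space and need not lie in \<open>C\<close>, so a cell may
    be empty.\<close>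
  define B where "B j m = C \<inter> ball (s j) (e m)" for j m
  \<comment> \<open>Asking for a good start in each of countably many cells is the Kuratowski-Ulam
    device: it turns density of good starts into countably many open conditions on \<open>F\<close>.
    Empty cells impose none.\<close>
  define E where "E = (\<lambda>(j, m, n, k).
    {F \<in> ?M. B j m = {} \<or> (\<exists>x\<in>B j m. \<exists>d. stably_narrow C n (e k) F x d)})"
  have "residual_in mtopology (\<Inter>i. E i)"
  proof (rule residual_in_INT)
    fix i :: "nat \<times> nat \<times> nat \<times> nat"
    obtain j m n k where i: "i = (j, m, n, k)" by (cases i)
    show "openin mtopology (E i)"
      unfolding openin_mtopology
    proof (intro conjI allI impI)
      show "E i \<subseteq> ?M" by (auto simp: E_def i)
      fix F assume F: "F \<in> E i"
      show "\<exists>r>0. mball F r \<subseteq> E i"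
      proof (cases "B j m = {}")
        case True
        then show ?thesis by (auto simp: E_def i intro: exI[of _ 1])
      next
        case False
        then obtain x d where x: "x \<in> B j m" "stably_narrow C n (e k) F x d" "F \<in> ?M"
          using F unfolding E_def i by blast
        then have d: "0 < d" by (simp add: stably_narrow_def)
        have "mball F (d / 2) \<subseteq> E i"
        proof
          fix G assume "G \<in> mball F (d / 2)"
          then have "stably_narrow C n (e k) G x (d / 2)" "G \<in> ?M"
            using stably_narrow_nearby[OF assms(2,5) x(2,3), of G x] d by auto
          then show "G \<in> E i" using x(1) by (auto simp: E_def i)
        qed
        then show ?thesis using d by (intro exI[of _ "d / 2"]) simp
      qed
    qed
    show "mtopology closure_of E i = topspace mtopology"
      unfolding dense_intersects_open
    proof (intro allI impI, elim conjE)
      fix V assume V: "openin mtopology V" "V \<noteq> {}"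
      then obtain F where F: "F \<in> V" by blast
      then obtain r where r: "0 < r" "mball F r \<subseteq> V" and FM: "F \<in> ?M"
        using V unfolding openin_mtopology by blast
      show "E i \<inter> V \<noteq> {}"
      proof (cases "B j m = {}")
        case True
        then show ?thesis using F FM by (auto simp: E_def i)
      next
        case False
        \<comment> \<open>Any start in the cell will do, since goodness at a prescribed start is
          dense among mappings.\<close>
        then obtain x where x: "x \<in> B j m" by blast
        then have "x \<in> C" by (simp add: B_def)
        then obtain G d where "G \<in> ?M" "?\<rho> F G < r" "stably_narrow C n (e k) G x d"
          using stably_narrow_dense[OF assms(2,4,5) FM _ e r(1)] by blast
        then have "G \<in> E i" "G \<in> mball F r" using x FM by (auto simp: E_def i)
        then show ?thesis using r by blast
      qed
    qed
  qed
  moreover have "\<exists>U. residual_in (top_of_set C) U \<and> (\<forall>x0\<in>U. \<exists>x. regular_trajectory C F x0 x)"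
    if F: "F \<in> (\<Inter>i. E i)" for F
  proof -
    have FM: "F \<in> ?M" using F by (auto simp: E_def)
    have F0: "?\<rho> F F = 0" using FM by simp
    \<comment> \<open>For the fixed \<open>F\<close>, openness comes from halving the radius,
      density from the membership of \<open>F\<close> in every \<open>E\<close>.\<close>
    define W where "W = (\<lambda>(n, k). {x \<in> C. \<exists>d. stably_narrow C n (e k) F x d})"
    have "residual_in (top_of_set C) (\<Inter>i. W i)"
    proof (rule residual_in_INT)
      fix i :: "nat \<times> nat"
      obtain n k where i: "i = (n, k)" by (cases i)
      show "openin (top_of_set C) (W i)"
        unfolding openin_euclidean_subtopology_iff
      proof (intro conjI ballI)
        show "W i \<subseteq> C" by (auto simp: W_def i)
        fix x assume "x \<in> W i"
        then obtain d where x: "stably_narrow C n (e k) F x d" by (auto simp: W_def i)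
        then have d: "0 < d" by (simp add: stably_narrow_def)
        have "x' \<in> W i" if "x' \<in> C" "dist x' x < d / 2" for x'
          using stably_narrow_nearby[OF assms(2,5) x FM FM, of x'] that d F0
          by (auto simp: W_def i dist_commute)
        then show "\<exists>r>0. \<forall>x'\<in>C. dist x' x < r \<longrightarrow> x' \<in> W i"
          using d by (intro exI[of _ "d / 2"]) simp
      qed
      show "top_of_set C closure_of W i = topspace (top_of_set C)"
        unfolding dense_intersects_open
      proof (intro allI impI, elim conjE)
        fix V assume V: "openin (top_of_set C) V" "V \<noteq> {}"
        then obtain x where x: "x \<in> V" by blast
        then obtain r where r: "0 < r" "\<And>x'. x' \<in> C \<Longrightarrow> dist x' x < r \<Longrightarrow> x' \<in> V" and xC: "x \<in> C"
          using V unfolding openin_euclidean_subtopology_iff by blast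
        \<comment> \<open>Two points of a cell of radius \<open>e m\<close> are less than 2 *
          \<open>e m\<close> apart, hence less than \<open>r\<close>.\<close>
        obtain m where m: "e m < r / 2"
          using reals_Archimedean[of "r / 2"] r(1) by (auto simp: e_def inverse_eq_divide)
        obtain j where j: "dist (s j) x < e m" using s[OF e] by blast
        then have "x \<in> B j m" using xC by (simp add: B_def)
        moreover have "F \<in> E (j, m, n, k)" using F by blast
        ultimately obtain x' where x': "x' \<in> B j m" "\<exists>d. stably_narrow C n (e k) F x' d"
          by (auto simp: E_def)
        have "dist x' x < r"
          using x'(1) j m dist_triangle[of x' x "s j"] by (simp add: B_def dist_commute)
        then have "x' \<in> V" using r x' by (simp add: B_def)
        moreover have "x' \<in> W i" using x' by (auto simp: W_def i B_def)
        ultimately show "W i \<inter> V \<noteq> {}" by blast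
      qed
    qed
    moreover have "\<exists>xs. regular_trajectory C F x xs" if x: "x \<in> (\<Inter>i. W i)" for x
    proof (rule regular_trajectory_if_reach_unique[OF FM])
      show xC: "x \<in> C" using x by (auto simp: W_def)
      fix n u v assume uv: "u \<in> reach F x n" "v \<in> reach F x n"
      \<comment> \<open>Stable narrowness is applied to \<open>F\<close> and \<open>x\<close>
        themselves.\<close>
      have small: "dist u v < e k" for k
      proof -
        have "x \<in> W (n, k)" using x by blast
        then show ?thesis using uv xC FM F0 by (auto simp: W_def stably_narrow_def)
      qed
      show "u = v"
      proof (rule ccontr)
        assume "u \<noteq> v"
        then obtain k where "e k < dist u v"
          using reals_Archimedean[of "dist u v"] by (auto simp: e_def inverse_eq_divide)
        then show False using small[of k] by simp
      qed
    qed
    ultimately show ?thesis by blast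
  qed
  ultimately show ?thesis by blast
qed

end
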